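(* Let $\Lambda=\{\lambda_k\}_{k\ge 0}$ be a non-decreasing sequence of positive numbers tending to $\infty$ and let $r\ge 2$ be an integer. If $f\in S(\Lambda^r)$, then $$\lim_{m\to\infty}\|s_m(f)-f\|_{S(\Lambda^r)}=0.$$
   Context: $C$ is the Banach space of $2\pi$-periodic continuous complex-valued functions on $\mathbb R$ with norm $\|f\|_C=\max_t|f(t)|$. For $f\in C$ with Fourier series $\frac12a_0(f)+\sum_{k\ge1}(a_k(f)\cos kt+b_k(f)\sin kt)$, $s_k(f)=s_k(f,t)$ denotes the $k$th partial sum (so $s_0(f)=\frac12a_0(f)$). Convention: $\lambda_{-1}=\dots=\lambda_{-r}=0$ and $s_{-1}(f)=\dots=s_{-r}(f)=0$. A function $f\in C$ belongs to $S(\Lambda^r)$ if $$\lim_{n\to\infty}\left\|\frac1{\lambda_n}\sum_{k=0}^n|\lambda_k(s_k(f)-f)-\lambda_{k-r}(s_{k-r}(f)-f)|\right\|_C=0.$$ The norm is $$\|f\|_{S(\Lambda^r)}=\sup_{n\ge0}\left\|\frac1{\lambda_n}\sum_{k=0}^n|\lambda_k s_k(f)-\lambda_{k-r}s_{k-r}(f)|\right\|_C.$$ *)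

theory Defs
  imports "HOL-Analysis.Analysis"
begin

definition C_per :: "(real \<Rightarrow> complex) set" where
  "C_per = {f. continuous_on UNIV f \<and> (\<forall>t. f (t + 2 * pi) = f t)}"

(* Polymorphic, because it is applied both to elements of C_per and to the real-valued sums below.
   All these functions are continuous and periodic, so the supremum is a maximum
   (sup_norm_attained). *)
definition sup_norm :: "(real \<Rightarrow> 'a::real_normed_vector) \<Rightarrow> real" where
  "sup_norm f = (SUP t. norm (f t))"

lemma sup_norm_attained:
  fixes f :: "real \<Rightarrow> 'a::real_normed_vector"
  assumes cont: "continuous_on UNIV f" and per: "\<And>t. f (t + 2 * pi) = f t"
  shows "\<exists>t0. sup_norm f = norm (f t0) \<and> (\<forall>t. norm (f t) \<le> norm (f t0))"
proof -
  have "continuous_on {0..2 * pi} (\<lambda>t. norm (f t))"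
    using cont by (intro continuous_on_norm) (rule continuous_on_subset, auto)
  then obtain t0 where t0: "\<forall>t\<in>{0..2 * pi}. norm (f t) \<le> norm (f t0)"
    using continuous_attains_sup[of "{0..2 * pi}" "\<lambda>t. norm (f t)"] by auto
  interpret periodic_fun_simple f "2 * pi"
    by standard (rule per)
  have le: "norm (f t) \<le> norm (f t0)" for t
  proof -
    define n where "n = \<lfloor>t / (2 * pi)\<rfloor>"
    have "of_int n \<le> t / (2 * pi)" "t / (2 * pi) < of_int n + 1"
      unfolding n_def by linarith+
    then have "of_int n * (2 * pi) \<le> t" "t < (of_int n + 1) * (2 * pi)"
      by (simp_all add: field_simps)
    then have "t - of_int n * (2 * pi) \<in> {0..2 * pi}"
      by (simp add: algebra_simps)
    with t0 show ?thesis
      using minus_of_int[of t n] by metis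
  qed
  then have "sup_norm f = norm (f t0)"
    unfolding sup_norm_def by (intro cSup_eq_maximum) auto
  with le show ?thesis by blast
qed

definition fourier_a :: "(real \<Rightarrow> complex) \<Rightarrow> nat \<Rightarrow> complex" where
  "fourier_a f k = of_real (1 / pi) * integral {-pi..pi} (\<lambda>t. f t * of_real (cos (real k * t)))"

definition fourier_b :: "(real \<Rightarrow> complex) \<Rightarrow> nat \<Rightarrow> complex" where
  "fourier_b f k = of_real (1 / pi) * integral {-pi..pi} (\<lambda>t. f t * of_real (sin (real k * t)))"

definition fourier_sum :: "(real \<Rightarrow> complex) \<Rightarrow> nat \<Rightarrow> real \<Rightarrow> complex" where
  "fourier_sum f k t = fourier_a f 0 / 2 +
     (\<Sum>j=1..k. fourier_a f j * of_real (cos (real j * t)) + fourier_b f j * of_real (sin (real j * t)))"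

(* Extension of a sequence by zero to negative indices. *)
definition zero_ext :: "(nat \<Rightarrow> 'a::zero) \<Rightarrow> int \<Rightarrow> 'a" where
  "zero_ext x j = (if j < 0 then 0 else x (nat j))"

definition S_space :: "(nat \<Rightarrow> real) \<Rightarrow> nat \<Rightarrow> (real \<Rightarrow> complex) set" where
  "S_space lam r = {f \<in> C_per.
     (\<lambda>n. sup_norm (\<lambda>t. 1 / lam n *
        (\<Sum>k=0..n. norm (of_real (lam k) * (fourier_sum f k t - f t)
            - of_real (zero_ext lam (int k - int r))
              * (zero_ext (\<lambda>i. fourier_sum f i t) (int k - int r) - f t)))))
     \<longlonglongrightarrow> 0}"

(* Valued in ennreal, since the supremum over n may be infinite for general f in C_per. *)
definition S_norm :: "(nat \<Rightarrow> real) \<Rightarrow> nat \<Rightarrow> (real \<Rightarrow> complex) \<Rightarrow> ennreal" where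
  "S_norm lam r f = (SUP n. ennreal (sup_norm (\<lambda>t. 1 / lam n *
     (\<Sum>k=0..n. norm (of_real (lam k) * fourier_sum f k t
         - of_real (zero_ext lam (int k - int r))
           * zero_ext (\<lambda>i. fourier_sum f i t) (int k - int r))))))"

end

theory Submission
  imports Defs
begin

text \<open>Write \<open>u\<^sub>k = s\<^sub>k(f) - f\<close>. Telescoping in steps of \<open>r\<close> bounds \<open>\<lambda>\<^sub>n |u\<^sub>n|\<close> by
  \<open>\<Sum>k\<le>n. |\<lambda>\<^sub>k u\<^sub>k - \<lambda>\<^bsub>k-r\<^esub> u\<^bsub>k-r\<^esub>|\<close>, so a function in \<open>S(\<Lambda>\<^sup>r)\<close> has a uniformly
  convergent Fourier series. Since \<open>s\<^sub>k(s\<^sub>m(f) - f)\<close> is \<open>0\<close> for \<open>k \<le> m\<close> and \<open>u\<^sub>m - u\<^sub>k\<close> for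
  \<open>k > m\<close>, the \<open>k\<close>th term of the norm of \<open>s\<^sub>m(f) - f\<close> is at most
  \<open>\<lambda>\<^sub>k (|u\<^sub>m| + |u\<^sub>k|)\<close> for the fewer than \<open>r\<close> indices \<open>m < k < m + r\<close>, and at most
  \<open>(\<lambda>\<^sub>k - \<lambda>\<^bsub>k-r\<^esub>) |u\<^sub>m| + |\<lambda>\<^sub>k u\<^sub>k - \<lambda>\<^bsub>k-r\<^esub> u\<^bsub>k-r\<^esub>|\<close> for \<open>k \<ge> m + r\<close>;
  the increments \<open>\<lambda>\<^sub>k - \<lambda>\<^bsub>k-r\<^esub>\<close> add up to at most \<open>r \<lambda>\<^sub>n\<close>.\<close>

section \<open>The supremum norm\<close>

text \<open>Continuity and periodicity enter because the real-valued \<open>SUP\<close> gives a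
  pointwise bound only when the norms are bounded above. The converse estimate below needs only a
  uniform bound.\<close>

lemma norm_le_sup_norm:
  fixes f :: "real \<Rightarrow> 'a::real_normed_vector"
  assumes "continuous_on UNIV f" "\<And>t. f (t + 2 * pi) = f t"
  shows "norm (f t) \<le> sup_norm f"
  using sup_norm_attained[OF assms] by metis

lemma sup_norm_le:
  assumes "\<And>t. norm (f t) \<le> B"
  shows "sup_norm f \<le> B"
  unfolding sup_norm_def using assms by (intro cSUP_least) auto

section \<open>Fourier coefficients of trigonometric polynomials\<close>

text \<open>Integer frequencies are allowed because the product-to-sum formulas produce
  \<open>j - k\<close>, which may be negative.\<close>

lemma has_integral_cos_of_int:
  "((\<lambda>t. cos (of_int n * t)) has_integral (if n = 0 then 2 * pi else 0)) {-pi..pi}"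
proof (cases "n = 0")
  case True
  then show ?thesis using has_integral_const_real[of "1::real" "-pi" pi] by simp
next
  case False
  have "((\<lambda>t. cos (of_int n * t)) has_integral
      (sin (of_int n * pi) / of_int n - sin (of_int n * (-pi)) / of_int n)) {-pi..pi}"
    using False
    by (intro fundamental_theorem_of_calculus)
       (auto intro!: derivative_eq_intros simp flip: has_real_derivative_iff_has_vector_derivative)
  moreover have "sin (of_int n * pi) = 0"
    by (metis mult.commute sin_integer_2pi sin_zero_iff_int2)
  ultimately show ?thesis using False by simp
qed

lemma has_integral_sin_of_int:
  "((\<lambda>t. sin (of_int n * t)) has_integral 0) {-pi..pi}"
proof (cases "n = 0")
  case False
  have "((\<lambda>t. sin (of_int n * t)) has_integral
      (- cos (of_int n * pi) / of_int n - (- cos (of_int n * (-pi)) / of_int n))) {-pi..pi}"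
    using False
    by (intro fundamental_theorem_of_calculus)
       (auto intro!: derivative_eq_intros simp flip: has_real_derivative_iff_has_vector_derivative)
  then show ?thesis by simp
qed simp

lemma has_integral_cos_cos:
  "((\<lambda>t. cos (real j * t) * cos (real k * t)) has_integral
     (if j = k then (if k = 0 then 2 * pi else pi) else 0)) {-pi..pi}"
proof -
  have product: "(\<lambda>t. cos (real j * t) * cos (real k * t)) =
      (\<lambda>t. (cos (of_int (int j - int k) * t) + cos (of_int (int j + int k) * t)) / 2)"
    by (simp add: cos_times_cos distrib_right left_diff_distrib)
  \<comment> \<open>The difference frequency vanishes for \<open>j = k\<close>, the sum frequency
    only for \<open>j = k = 0\<close>; this double hit is why the constant mode has weight
    \<open>2 * pi\<close>.\<close>
  have total: "((if int j - int k = 0 then 2 * pi else 0) +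
      (if int j + int k = 0 then 2 * pi else 0)) / 2 =
      (if j = k then (if k = 0 then 2 * pi else pi) else 0)"
    by auto
  show ?thesis
    unfolding product
    by (rule has_integral_eq_rhs[OF has_integral_divide[OF has_integral_add[OF
      has_integral_cos_of_int has_integral_cos_of_int]] total[symmetric]])
qed

lemma has_integral_sin_sin:
  "((\<lambda>t. sin (real j * t) * sin (real k * t)) has_integral
     (if j = k \<and> k \<noteq> 0 then pi else 0)) {-pi..pi}"
proof -
  have product: "(\<lambda>t. sin (real j * t) * sin (real k * t)) =
      (\<lambda>t. (cos (of_int (int j - int k) * t) - cos (of_int (int j + int k) * t)) / 2)"
    by (simp add: sin_times_sin distrib_right left_diff_distrib)
  have total: "((if int j - int k = 0 then 2 * pi else 0) -
      (if int j + int k = 0 then 2 * pi else 0)) / 2 = (if j = k \<and> k \<noteq> 0 then pi else 0)"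
    by auto
  show ?thesis
    unfolding product
    by (rule has_integral_eq_rhs[OF has_integral_divide[OF has_integral_diff[OF
      has_integral_cos_of_int has_integral_cos_of_int]] total[symmetric]])
qed

lemma has_integral_sin_cos:
  "((\<lambda>t. sin (real j * t) * cos (real k * t)) has_integral 0) {-pi..pi}"
proof -
  have product: "(\<lambda>t. sin (real j * t) * cos (real k * t)) =
      (\<lambda>t. (sin (of_int (int j + int k) * t) + sin (of_int (int j - int k) * t)) / 2)"
    by (simp add: sin_times_cos distrib_right left_diff_distrib)
  show ?thesis
    unfolding product
    by (rule has_integral_eq_rhs[OF has_integral_divide[OF has_integral_add[OF
      has_integral_sin_of_int has_integral_sin_of_int]]]) simp
qed

lemma has_integral_cos_sin:
  "((\<lambda>t. cos (real j * t) * sin (real k * t)) has_integral 0) {-pi..pi}"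
  using has_integral_sin_cos[of k j] by (simp only: mult.commute)

lemma has_integral_const_mult_of_real:
  fixes c :: complex
  assumes "(f has_integral I) S"
  shows "((\<lambda>t. c * of_real (f t)) has_integral (c * of_real I)) S"
  by (intro has_integral_mult_right has_integral_of_real assms)

text \<open>The coefficients are free parameters, so orthogonality recovers them without mentioning
  the function whose partial sum is taken.\<close>

definition trig_poly :: "complex \<Rightarrow> (nat \<Rightarrow> complex) \<Rightarrow> (nat \<Rightarrow> complex) \<Rightarrow> nat \<Rightarrow> real \<Rightarrow> complex" where
  "trig_poly c A B m t =
     c + (\<Sum>j=1..m. A j * of_real (cos (real j * t)) + B j * of_real (sin (real j * t)))"

lemma fourier_sum_eq_trig_poly:
  "fourier_sum f m = trig_poly (fourier_a f 0 / 2) (fourier_a f) (fourier_b f) m"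
  by (simp add: fun_eq_iff fourier_sum_def trig_poly_def)

lemma fourier_a_trig_poly:
  "fourier_a (trig_poly c A B m) k = (if k = 0 then 2 * c else if k \<le> m then A k else 0)"
proof -
  \<comment> \<open>The constant is written as the cosine of frequency \<open>0\<close>, so that the
    orthogonality relations cover it too.\<close>
  have int: "((\<lambda>t. c * of_real (cos (real 0 * t) * cos (real k * t)) +
       (\<Sum>j=1..m. A j * of_real (cos (real j * t) * cos (real k * t))
                + B j * of_real (sin (real j * t) * cos (real k * t)))) has_integral
     (c * of_real (if 0 = k then (if k = 0 then 2 * pi else pi) else 0) +
       (\<Sum>j=1..m. A j * of_real (if j = k then (if k = 0 then 2 * pi else pi) else 0)
                + B j * of_real 0))) {-pi..pi}"
    by (intro has_integral_add has_integral_sum has_integral_const_mult_of_real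
        has_integral_cos_cos has_integral_sin_cos) auto
  have coeff: "(\<Sum>j=1..m. A j * of_real (if j = k then (if k = 0 then 2 * pi else pi) else 0)
                + B j * of_real 0) = (\<Sum>j=1..m. if j = k then pi * A k else 0)"
    by (rule sum.cong) auto
  have product: "(\<lambda>t. c * of_real (cos (real 0 * t) * cos (real k * t)) +
       (\<Sum>j=1..m. A j * of_real (cos (real j * t) * cos (real k * t))
                + B j * of_real (sin (real j * t) * cos (real k * t)))) =
     (\<lambda>t. trig_poly c A B m t * of_real (cos (real k * t)))"
    by (simp add: fun_eq_iff trig_poly_def distrib_right sum_distrib_right mult.assoc)
  have "((\<lambda>t. trig_poly c A B m t * of_real (cos (real k * t))) has_integral
     (if k = 0 then 2 * pi * c else if k \<le> m then pi * A k else 0)) {-pi..pi}"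
    using int unfolding coeff product by (rule has_integral_eq_rhs) auto
  then show ?thesis unfolding fourier_a_def by (simp add: integral_unique)
qed

lemma fourier_b_trig_poly:
  "fourier_b (trig_poly c A B m) k = (if k \<noteq> 0 \<and> k \<le> m then B k else 0)"
proof -
  have int: "((\<lambda>t. c * of_real (cos (real 0 * t) * sin (real k * t)) +
       (\<Sum>j=1..m. A j * of_real (cos (real j * t) * sin (real k * t))
                + B j * of_real (sin (real j * t) * sin (real k * t)))) has_integral
     (c * of_real 0 +
       (\<Sum>j=1..m. A j * of_real 0 + B j * of_real (if j = k \<and> k \<noteq> 0 then pi else 0))))
     {-pi..pi}"
    by (intro has_integral_add has_integral_sum has_integral_const_mult_of_real
        has_integral_sin_sin has_integral_cos_sin) auto
  have coeff: "(\<Sum>j=1..m. A j * of_real 0 + B j * of_real (if j = k \<and> k \<noteq> 0 then pi else 0))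
      = (\<Sum>j=1..m. if j = k then pi * B k else 0)"
    by (rule sum.cong) auto
  have product: "(\<lambda>t. c * of_real (cos (real 0 * t) * sin (real k * t)) +
       (\<Sum>j=1..m. A j * of_real (cos (real j * t) * sin (real k * t))
                + B j * of_real (sin (real j * t) * sin (real k * t)))) =
     (\<lambda>t. trig_poly c A B m t * of_real (sin (real k * t)))"
    by (simp add: fun_eq_iff trig_poly_def distrib_right sum_distrib_right mult.assoc)
  have "((\<lambda>t. trig_poly c A B m t * of_real (sin (real k * t))) has_integral
     (if k \<noteq> 0 \<and> k \<le> m then pi * B k else 0)) {-pi..pi}"
    using int unfolding coeff product by (rule has_integral_eq_rhs) auto
  then show ?thesis unfolding fourier_b_def by (simp add: integral_unique)
qed

lemma continuous_on_fourier_sum: "continuous_on S (fourier_sum f m)"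
  unfolding fourier_sum_def[abs_def] by (intro continuous_intros)

lemma fourier_sum_periodic: "fourier_sum f m (t + 2 * pi) = fourier_sum f m t"
proof -
  have "cos (real j * (t + 2 * pi)) = cos (real j * t)"
    and "sin (real j * (t + 2 * pi)) = sin (real j * t)" for j
    using cos.plus_of_nat[of "real j * t" j] sin.plus_of_nat[of "real j * t" j]
    by (simp_all add: distrib_left)
  then show ?thesis by (simp add: fourier_sum_def)
qed

section \<open>Partial sums of a remainder\<close>

lemma fourier_a_diff:
  assumes "continuous_on UNIV f" "continuous_on UNIV g"
  shows "fourier_a (\<lambda>t. f t - g t) k = fourier_a f k - fourier_a g k"
proof -
  have "(\<lambda>t. h t * complex_of_real (cos (real k * t))) integrable_on {-pi..pi}"
    if "continuous_on UNIV h" for h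
    by (intro integrable_continuous_real continuous_intros continuous_on_subset[OF that]) auto
  from integral_diff[OF this[OF assms(1)] this[OF assms(2)]] show ?thesis
    by (simp add: fourier_a_def left_diff_distrib diff_divide_distrib)
qed

lemma fourier_b_diff:
  assumes "continuous_on UNIV f" "continuous_on UNIV g"
  shows "fourier_b (\<lambda>t. f t - g t) k = fourier_b f k - fourier_b g k"
proof -
  have "(\<lambda>t. h t * complex_of_real (sin (real k * t))) integrable_on {-pi..pi}"
    if "continuous_on UNIV h" for h
    by (intro integrable_continuous_real continuous_intros continuous_on_subset[OF that]) auto
  from integral_diff[OF this[OF assms(1)] this[OF assms(2)]] show ?thesis
    by (simp add: fourier_b_def left_diff_distrib diff_divide_distrib)
qed

lemma fourier_sum_diff:
  assumes "continuous_on UNIV f" "continuous_on UNIV g"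
  shows "fourier_sum (\<lambda>t. f t - g t) k t = fourier_sum f k t - fourier_sum g k t"
  by (simp add: fourier_sum_def fourier_a_diff[OF assms] fourier_b_diff[OF assms]
      diff_divide_distrib left_diff_distrib sum_subtractf sum.distrib)

text \<open>By orthogonality, \<open>fourier_sum f m\<close> has the coefficients of
  \<open>f\<close> up to \<open>m\<close> and zeros beyond, so a second truncation keeps only the
  smaller order.\<close>

lemma fourier_sum_fourier_sum: "fourier_sum (fourier_sum f m) k t = fourier_sum f (min k m) t"
proof -
  have "(\<Sum>j=1..k. fourier_a (fourier_sum f m) j * of_real (cos (real j * t))
               + fourier_b (fourier_sum f m) j * of_real (sin (real j * t)))
      = (\<Sum>j=1..min k m. fourier_a f j * of_real (cos (real j * t))
               + fourier_b f j * of_real (sin (real j * t)))"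
    by (rule sum.mono_neutral_cong_right)
       (auto simp: fourier_sum_eq_trig_poly fourier_a_trig_poly fourier_b_trig_poly)
  then show ?thesis
    unfolding fourier_sum_def[of "fourier_sum f m"] fourier_sum_def[of f "min k m"]
    by (simp add: fourier_sum_eq_trig_poly fourier_a_trig_poly)
qed

section \<open>Weighted differences with step \<open>r\<close>\<close>

text \<open>The shift by \<open>r\<close> on natural indices; the explicit case split stands for the
  zero convention at negative indices, which truncated subtraction would lose.\<close>

definition lag :: "nat \<Rightarrow> (nat \<Rightarrow> 'a::zero) \<Rightarrow> nat \<Rightarrow> 'a" where
  "lag r x k = (if k < r then 0 else x (k - r))"

lemma zero_ext_eq_lag: "zero_ext x (int k - int r) = lag r x k"
  by (auto simp: zero_ext_def lag_def nat_diff_distrib simp flip: of_nat_diff)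

text \<open>Strong induction along \<open>n\<close>, \<open>n - r\<close>, ... down to an index
  below \<open>r\<close>, where \<open>lag\<close> is \<open>0\<close>. Only one residue class
  modulo \<open>r\<close> is used; the other summands are nonnegative.\<close>

lemma norm_le_sum_lag_diff:
  fixes x :: "nat \<Rightarrow> 'a::real_normed_vector"
  assumes "0 < r"
  shows "norm (x n) \<le> (\<Sum>k=0..n. norm (x k - lag r x k))"
proof (induction n rule: less_induct)
  case (less n)
  show ?case
  proof (cases "n < r")
    case True
    then have "norm (x n) = norm (x n - lag r x n)" by (simp add: lag_def)
    also have "\<dots> \<le> (\<Sum>k=0..n. norm (x k - lag r x k))"
      by (rule member_le_sum) auto
    finally show ?thesis .
  next
    case False
    have "norm (x n) \<le> norm (x (n - r)) + norm (x n - lag r x n)"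
      using False norm_triangle_sub[of "x n" "x (n - r)"] by (simp add: lag_def)
    also have "\<dots> \<le> (\<Sum>k=0..n-r. norm (x k - lag r x k)) + norm (x n - lag r x n)"
      using less[of "n - r"] False assms by simp
    also have "\<dots> = (\<Sum>k\<in>insert n {0..n-r}. norm (x k - lag r x k))"
      using False assms by (subst sum.insert) auto
    also have "\<dots> \<le> (\<Sum>k=0..n. norm (x k - lag r x k))"
      by (rule sum_mono2) auto
    finally show ?thesis .
  qed
qed

text \<open>Everything cancels except the last \<open>r\<close> entries; for \<open>n < r\<close>
  truncated subtraction makes the right-hand side the full sum.\<close>

lemma sum_lag_diff:
  fixes x :: "nat \<Rightarrow> 'a::ab_group_add"
  assumes "0 < r"
  shows "(\<Sum>k=0..n. x k - lag r x k) = (\<Sum>k=Suc n-r..n. x k)"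
proof (induction n)
  case 0
  from assms show ?case by (simp add: lag_def)
next
  case (Suc n)
  show ?case
  proof (cases "Suc n < r")
    case True
    with Suc show ?thesis by (simp add: lag_def)
  next
    case False
    have "{Suc n - r..n} = insert (Suc n - r) {Suc (Suc n) - r..n}"
      using False assms by auto
    then have "(\<Sum>k=Suc n-r..n. x k) = x (Suc n - r) + (\<Sum>k=Suc (Suc n)-r..n. x k)"
      using False by simp
    moreover have "Suc (Suc n) - r \<le> Suc n" using assms by simp
    ultimately show ?thesis using Suc False by (simp add: lag_def)
  qed
qed

lemma sum_lag_diff_le:
  fixes x :: "nat \<Rightarrow> real"
  assumes "0 < r" "incseq x" "\<And>k. 0 \<le> x k"
  shows "(\<Sum>k=0..n. x k - lag r x k) \<le> real r * x n"
proof -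
  have "(\<Sum>k=Suc n-r..n. x k) \<le> (\<Sum>k=Suc n-r..n. x n)"
    using assms(2) by (intro sum_mono) (auto simp: incseq_def)
  also have "\<dots> \<le> real r * x n"
    using assms(3)[of n] by (auto intro!: mult_right_mono)
  finally show ?thesis unfolding sum_lag_diff[OF assms(1)] .
qed

lemma lag_le:
  fixes x :: "nat \<Rightarrow> real"
  assumes "incseq x" "\<And>k. 0 \<le> x k"
  shows "lag r x k \<le> x k"
  using assms by (auto simp: lag_def incseq_def)

text \<open>The sequence \<open>v\<close> plays the role of \<open>s\<^sub>k(s\<^sub>m(f) - f)\<close>.\<close>

lemma sum_remainder_le:
  fixes lam :: "nat \<Rightarrow> real" and u v :: "nat \<Rightarrow> 'a::real_normed_vector"
  assumes r: "0 < r" and inc: "incseq lam" and nonneg: "\<And>k. 0 \<le> lam k"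
    and u: "\<And>k. m \<le> k \<Longrightarrow> norm (u k) \<le> e"
    and v0: "\<And>k. k \<le> m \<Longrightarrow> v k = 0" and v1: "\<And>k. m < k \<Longrightarrow> v k = u m - u k"
  shows "(\<Sum>k=0..n. norm (lam k *\<^sub>R v k - lag r (\<lambda>k. lam k *\<^sub>R v k) k))
    \<le> 3 * real r * e * lam n + (\<Sum>k=0..n. norm (lam k *\<^sub>R u k - lag r (\<lambda>k. lam k *\<^sub>R u k) k))"
    (is "?L \<le> _ + ?R")
proof -
  have e: "0 \<le> e" using u[of m] norm_ge_zero[of "u m"] by linarith
  define D where "D k = norm (lam k *\<^sub>R u k - lag r (\<lambda>k. lam k *\<^sub>R u k) k)" for k
  \<comment> \<open>\<open>I\<close> charges the block of \<open>r\<close> indices after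
    \<open>m\<close> where the lagged term is still zero and \<open>v k\<close> is estimated only by
    \<open>2 * e\<close>.\<close>
  define I where "I k = (if k \<in> {m..<m + r} then 2 * e * lam n else 0)" for k
  have mono: "i \<le> j \<Longrightarrow> lam i \<le> lam j" for i j using inc by (simp add: incseq_def)
  \<comment> \<open>At \<open>k = m\<close> both sides are zero; this case is needed when
    \<open>k - r = m\<close>.\<close>
  have v1': "v k = u m - u k" if "m \<le> k" for k
    using that v0[of k] v1[of k] by (cases "k = m") auto
  have le: "norm (lam k *\<^sub>R v k - lag r (\<lambda>k. lam k *\<^sub>R v k) k)
      \<le> I k + (lam k - lag r lam k) * e + D k"
    if "k \<le> n" for k
  proof -
    have pos: "0 \<le> (lam k - lag r lam k) * e" "0 \<le> D k" "0 \<le> I k"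
      using lag_le[OF inc nonneg] e nonneg by (auto simp: D_def I_def)
    consider "k < m" | "m \<le> k" "k < m + r" | "m + r \<le> k" by linarith
    then show ?thesis
    proof cases
      case 1
      then have "lag r (\<lambda>k. lam k *\<^sub>R v k) k = 0" "v k = 0" by (auto simp: lag_def v0)
      with pos show ?thesis by simp
    next
      case 2
      then have "k - r \<le> m" by linarith
      then have lag0: "lag r (\<lambda>k. lam k *\<^sub>R v k) k = 0" by (simp add: lag_def v0)
      have "norm (v k) \<le> 2 * e"
        using norm_triangle_ineq4[of "u m" "u k"] u[of m] u[of k] 2 by (simp add: v1')
      then have "lam k * norm (v k) \<le> lam n * (2 * e)"
        using mono[OF that] nonneg by (intro mult_mono) auto
      then have "norm (lam k *\<^sub>R v k) \<le> I k"
        using 2 nonneg[of k] by (simp add: I_def mult_ac)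
      with lag0 pos show ?thesis by simp
    next
      case 3
      then have "m \<le> k - r" "m \<le> k" "r \<le> k" by linarith+
      then have "lam k *\<^sub>R v k - lag r (\<lambda>k. lam k *\<^sub>R v k) k =
          (lam k - lag r lam k) *\<^sub>R u m - (lam k *\<^sub>R u k - lag r (\<lambda>k. lam k *\<^sub>R u k) k)"
        by (simp add: lag_def v1' algebra_simps)
      then have "norm (lam k *\<^sub>R v k - lag r (\<lambda>k. lam k *\<^sub>R v k) k)
          \<le> norm ((lam k - lag r lam k) *\<^sub>R u m) + D k"
        unfolding D_def by (metis norm_triangle_ineq4)
      also have "norm ((lam k - lag r lam k) *\<^sub>R u m) \<le> (lam k - lag r lam k) * e"
        using lag_le[OF inc nonneg, of r k] u[of m] by (simp add: mult_left_mono)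
      finally show ?thesis using pos by simp
    qed
  qed
  have "?L \<le> (\<Sum>k=0..n. I k + (lam k - lag r lam k) * e + D k)"
    by (rule sum_mono) (use le in auto)
  also have "\<dots> = (\<Sum>k=0..n. I k) + (\<Sum>k=0..n. lam k - lag r lam k) * e + ?R"
    by (simp add: sum.distrib sum_distrib_right D_def)
  \<comment> \<open>The range is enlarged to contain the whole block, which may extend past
    \<open>n\<close>. The block then costs \<open>2 * r\<close> and the increments of
    \<open>lam\<close> cost \<open>r\<close>, giving the factor \<open>3 * r\<close>.\<close>
  also have "(\<Sum>k=0..n. I k) \<le> (\<Sum>k\<in>{0..n} \<union> {m..<m + r}. I k)"
    using e nonneg by (intro sum_mono2) (auto simp: I_def)
  also have "\<dots> = (\<Sum>k\<in>{m..<m + r}. I k)"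
    by (rule sum.mono_neutral_right) (auto simp: I_def)
  also have "\<dots> = 2 * real r * e * lam n"
    by (simp add: I_def)
  also have "(\<Sum>k=0..n. lam k - lag r lam k) * e \<le> real r * lam n * e"
    using sum_lag_diff_le[OF r inc nonneg] e by (intro mult_right_mono)
  finally show ?thesis by (simp add: algebra_simps)
qed

section \<open>Convergence in the norm\<close>

theorem theorem4:
  fixes lam :: "nat \<Rightarrow> real" and r :: nat and f :: "real \<Rightarrow> complex"
  assumes "\<And>k. 0 < lam k"
    and "incseq lam"
    and "filterlim lam at_top sequentially"
    and "r \<ge> 2"
    and "f \<in> S_space lam r"
  shows "(\<lambda>m. S_norm lam r (\<lambda>t. fourier_sum f m t - f t)) \<longlonglongrightarrow> 0"
proof -
  define u where "u k t = fourier_sum f k t - f t" for k t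
  define T where "T x n = (\<Sum>k=0..n. norm (lam k *\<^sub>R x k - lag r (\<lambda>k. lam k *\<^sub>R x k) k))"
    for x :: "nat \<Rightarrow> complex" and n
  define A where "A n = sup_norm (\<lambda>t. 1 / lam n * T (\<lambda>k. u k t) n)" for n
  have r: "0 < r" using assms(4) by simp
  have nonneg: "0 \<le> lam k" for k using assms(1)[of k] by simp
  have cont: "continuous_on UNIV f" and per: "f (t + 2 * pi) = f t" for t
    using assms(5) by (auto simp: S_space_def C_per_def)
  \<comment> \<open>For \<open>k < r\<close> the factor \<open>zero_ext lam\<close> is
    \<open>0\<close>, so the stray \<open>- f t\<close> disappears and the product can be lagged as
    one sequence.\<close>
  have term_f: "norm (of_real (lam k) * (fourier_sum f k t - f t)
            - of_real (zero_ext lam (int k - int r))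
              * (zero_ext (\<lambda>i. fourier_sum f i t) (int k - int r) - f t))
      = norm (lam k *\<^sub>R u k t - lag r (\<lambda>k. lam k *\<^sub>R u k t) k)" for k t
    by (simp add: zero_ext_eq_lag lag_def u_def scaleR_conv_of_real)
  have A: "A \<longlonglongrightarrow> 0"
    using assms(5) unfolding S_space_def mem_Collect_eq term_f A_def T_def by blast
  have T_le: "T (\<lambda>k. u k t) n \<le> lam n * A n" for t n
  proof -
    have "norm (1 / lam n * T (\<lambda>k. u k t) n) \<le> A n"
      unfolding A_def
    proof (rule norm_le_sup_norm)
      have "continuous_on UNIV (\<lambda>t. lag r (\<lambda>k. lam k *\<^sub>R u k t) k)" for k
        by (cases "k < r")
           (auto simp: lag_def u_def intro!: continuous_intros continuous_on_fourier_sum cont)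
      then show "continuous_on UNIV (\<lambda>t. 1 / lam n * T (\<lambda>k. u k t) n)"
        unfolding T_def u_def
        by (intro continuous_intros continuous_on_fourier_sum cont) auto
    qed (simp add: u_def per fourier_sum_periodic)
    moreover have "0 \<le> T (\<lambda>k. u k t) n" unfolding T_def by (simp add: sum_nonneg)
    ultimately show ?thesis
      using assms(1)[of n] by (simp add: field_simps)
  qed
  \<comment> \<open>Telescoping \<open>lam k *\<^sub>R u k t\<close> and cancelling
    \<open>lam n\<close> gives uniform convergence of the partial sums, with the same rate
    \<open>A\<close>.\<close>
  have u_le: "norm (u n t) \<le> A n" for n t
  proof -
    have "lam n * norm (u n t) \<le> lam n * A n"
      using norm_le_sum_lag_diff[OF r, of "\<lambda>k. lam k *\<^sub>R u k t" n] T_le[of t n] nonneg[of n]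
      by (simp add: T_def)
    then show ?thesis using assms(1)[of n] by simp
  qed
  \<comment> \<open>The factor is \<open>3 * r\<close> from the remainder estimate plus
    \<open>1\<close> from the defining averages of \<open>f\<close>. Only \<open>A k\<close> with
    \<open>m \<le> k\<close> has to be small.\<close>
  have S_le: "S_norm lam r (\<lambda>t. fourier_sum f m t - f t) \<le> ennreal ((3 * real r + 1) * e)"
    if e: "\<And>k. m \<le> k \<Longrightarrow> A k \<le> e" for m e
  proof -
    define v where "v k t = fourier_sum (\<lambda>t. fourier_sum f m t - f t) k t" for k t
    have v: "v k t = fourier_sum f (min k m) t - fourier_sum f k t" for k t
      unfolding v_def
      by (simp add: fourier_sum_diff[OF continuous_on_fourier_sum cont] fourier_sum_fourier_sum)
    have term_v: "norm (of_real (lam k) * v k t - of_real (zero_ext lam (int k - int r))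
              * (zero_ext (\<lambda>i. v i t) (int k - int r)))
      = norm (lam k *\<^sub>R v k t - lag r (\<lambda>k. lam k *\<^sub>R v k t) k)" for k t
      by (simp add: zero_ext_eq_lag lag_def scaleR_conv_of_real)
    have e0: "0 \<le> e"
      using u_le[of m 0] e[of m] norm_ge_zero[of "u m 0"] by linarith
    have bound: "T (\<lambda>k. v k t) n \<le> (3 * real r + 1) * e * lam n" for n t
    proof (cases "m \<le> n")
      case True
      have "T (\<lambda>k. v k t) n \<le> 3 * real r * e * lam n + T (\<lambda>k. u k t) n"
        unfolding T_def
      proof (rule sum_remainder_le[OF r assms(2) nonneg])
        show "norm (u k t) \<le> e" if "m \<le> k" for k using u_le[of k t] e[OF that] by linarith
      qed (auto simp: v u_def)
      also have "T (\<lambda>k. u k t) n \<le> lam n * e"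
        using T_le[of t n] mult_left_mono[OF e[OF True] nonneg[of n]] by linarith
      finally show ?thesis by (simp add: algebra_simps)
    \<comment> \<open>For \<open>n < m\<close> every \<open>v k\<close> with
      \<open>k \<le> n\<close> vanishes, so no control of \<open>A n\<close> is required.\<close>
    next
      case False
      then have "T (\<lambda>k. v k t) n = 0"
        unfolding T_def by (intro sum.neutral) (auto simp: lag_def v min_def)
      with e0 nonneg[of n] show ?thesis by simp
    qed
    have "sup_norm (\<lambda>t. 1 / lam n * T (\<lambda>k. v k t) n) \<le> (3 * real r + 1) * e" for n
    proof (rule sup_norm_le)
      fix t
      have "0 \<le> T (\<lambda>k. v k t) n" unfolding T_def by (simp add: sum_nonneg)
      with bound[of t n] show "norm (1 / lam n * T (\<lambda>k. v k t) n) \<le> (3 * real r + 1) * e"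
        using assms(1)[of n] by (simp add: field_simps)
    qed
    then show ?thesis
      unfolding S_norm_def v_def[symmetric] term_v T_def[symmetric]
      by (intro SUP_least ennreal_leI)
  qed
  show ?thesis
  proof (rule order_tendstoI)
    fix a :: ennreal
    assume "0 < a"
    \<comment> \<open>Passing below \<open>a\<close> yields a finite positive real \<open>c\<close>,
      even if \<open>a\<close> is infinite; \<open>e\<close> is then scaled so that the bound equals
      \<open>c\<close>.\<close>
    then obtain b where "0 < b" "b < a" using dense by blast
    then obtain c where c: "b = ennreal c" "0 < c"
      by (cases b) (auto simp: less_top)
    define e where "e = c / (3 * real r + 1)"
    have "0 < e" using c by (simp add: e_def)
    then obtain M where M: "\<And>k. M \<le> k \<Longrightarrow> A k < e"
      using order_tendstoD(2)[OF A] unfolding eventually_sequentially by blast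
    have "S_norm lam r (\<lambda>t. fourier_sum f m t - f t) < a" if "M \<le> m" for m
    proof -
      have "S_norm lam r (\<lambda>t. fourier_sum f m t - f t) \<le> ennreal ((3 * real r + 1) * e)"
        using M that by (intro S_le) (meson less_imp_le order_trans)
      also have "(3 * real r + 1) * e = c"
        by (simp add: e_def nonzero_eq_divide_eq add_nonneg_eq_0_iff)
      finally show ?thesis using c \<open>b < a\<close> by simp
    qed
    then show "\<forall>\<^sub>F m in sequentially. S_norm lam r (\<lambda>t. fourier_sum f m t - f t) < a"
      unfolding eventually_sequentially by blast
  qed auto
qed

end
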